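(* Let $f_1,\dots,f_n:\mathbb{R}^d\to\mathbb{R}$ be differentiable functions such that, for constants $\mu>0$ and $L_1,\dots,L_n>0$, for all $i\in\{1,\dots,n\}$ and all $x,y\in\mathbb{R}^d$, $\frac{\mu}{2}\|x-y\|^2\le D_{f_i}(x,y)\le\frac{L_i}{2}\|x-y\|^2$. Put $\kappa_i=L_i/\mu$, $\kappa_{\max}=\max_i\kappa_i$ and $L_{\max}=\max_i L_i$. Choose probabilities $$q_i=\frac{1-\frac{1}{\kappa_i}}{1-\frac{1}{\kappa_{\max}}}\le 1\qquad\text{and}\qquad p=\frac{1}{\sqrt{\kappa_{\max}}} .$$ Then, with the largest admissible stepsize $\gamma=1/L_{\max}$ (admissible meaning $\gamma\le\min_i\left\{\frac{1}{L_i}\frac{p^2}{1-q_i(1-p^2)}\right\}$), the GradSkip algorithm enjoys the following properties: (i) $\mathcal{O}(\kappa_{\max}\log\frac1\varepsilon)$ iteration complexity; (ii) $\mathcal{O}(\sqrt{\kappa_{\max}}\log\frac1\varepsilon)$ communication complexity; (iii) for each client $i\in\{1,\dots,n\}$, the expected number of local gradient computations per communication round is $$\frac{1}{1-q_i(1-p)}=\frac{\kappa_i(1+\sqrt{\kappa_{\max}})}{\kappa_i+\sqrt{\kappa_{\max}}}\le\min\{\kappa_i,\sqrt{\kappa_{\max}}\}.$$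
   Context: $D_{g}(x,y):=g(x)-g(y)-\langle\nabla g(y),x-y\rangle$ is the Bregman divergence of a differentiable $g$. The problem is to minimize $f(x)=\frac1n\sum_{i=1}^n f_i(x)$ over $x\in\mathbb{R}^d$; $x_\star$ is its unique minimizer, $h_{i,\star}:=\nabla f_i(x_\star)$, and $$\Psi_t:=\sum_{i=1}^n\|x_{i,t}-x_\star\|^2+\frac{\gamma^2}{p^2}\sum_{i=1}^n\|h_{i,t}-h_{i,\star}\|^2 .$$ GradSkip algorithm. Input: stepsize $\gamma>0$, synchronization probability $p$ and probabilities $q_1,\dots,q_n$ controlling local steps, with $0<p,q_i\le1$, initial local iterates $x_{1,0}=\dots=x_{n,0}\in\mathbb{R}^d$, and initial shifts $h_{1,0},\dots,h_{n,0}\in\mathbb{R}^d$. The coins $\theta_t$, $\eta_{i,t}$ ($t\ge0$, $1\le i\le n$) are independent $\{0,1\}$-valued random variables with $\mathrm{Prob}(\theta_t=1)=p$ and $\mathrm{Prob}(\eta_{i,t}=1)=q_i$. For $t=0,1,2,\dots$ and every client $i\in\{1,\dots,n\}$: (1) $\hat h_{i,t+1}=\eta_{i,t}h_{i,t}+(1-\eta_{i,t})\nabla f_i(x_{i,t})$; (2) $\hat x_{i,t+1}=x_{i,t}-\gamma(\nabla f_i(x_{i,t})-\hat h_{i,t+1})$; (3) if $\theta_t=1$ (a communication) then $x_{i,t+1}=\frac1n\sum_{j=1}^n\left(\hat x_{j,t+1}-\frac{\gamma}{p}\hat h_{j,t+1}\right)$, otherwise $x_{i,t+1}=\hat x_{i,t+1}$;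 (4) $h_{i,t+1}=\hat h_{i,t+1}+\frac{p}{\gamma}(x_{i,t+1}-\hat x_{i,t+1})$. Meaning of (i) and (ii): iteration complexity is the number $T$ of iterations after which $\mathbb{E}[\Psi_T]\le\varepsilon\Psi_0$ is guaranteed, for small $\varepsilon>0$; communication complexity is the expected number of communications (indices $t<T$ with $\theta_t=1$) during these $T$ iterations; the constants in $\mathcal{O}$ are absolute. Number of local gradient computations per communication round: a communication round starts right after a communication (or at $t=0$) and ends with the next iteration in which $\theta_t=1$. Within a round, client $i$ needs to compute gradients only up to and including the first iteration of the round in which its coin $\eta_{i,t}$ equals $0$ (afterwards its iterate does not move until the next communication). Thus the number of local gradient computations of client $i$ in a round is $\min\{\Theta,H_i\}$, where $\Theta$ is the number of tosses of the coins $\theta_t$ up to and including the first occurrence of $\theta_t=1$ and $H_i$ (possibly $+\infty$) is the number of tosses of the coins $\eta_{i,t}$ up to and including the first occurrence of $\eta_{i,t}=0$, counted from the start of the round. *)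

theory Defs
  imports "HOL-Probability.Probability"
begin

definition grad :: "('a::euclidean_space \<Rightarrow> real) \<Rightarrow> 'a \<Rightarrow> 'a" where
  "grad f x = (THE D. GDERIV f x :> D)"

definition bregman :: "('a::euclidean_space \<Rightarrow> real) \<Rightarrow> 'a \<Rightarrow> 'a \<Rightarrow> real" where
  "bregman g x y = g x - g y - grad g y \<bullet> (x - y)"

definition mean :: "('n::finite \<Rightarrow> 'b::real_vector) \<Rightarrow> 'b" where
  "mean v = (1 / real CARD('n)) *\<^sub>R (\<Sum>i\<in>UNIV. v i)"

text \<open>Clients are indexed by the finite type \<open>'n\<close>, so that \<open>n = CARD('n)\<close>. The two arguments
  \<open>x\<close>, \<open>h\<close> are the families of all local iterates and of all shifts at the current time; the coins
  are truth values, \<open>True\<close> standing for 1. The functions of this group are deterministic: they take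
  the outcomes of the coin tosses as arguments.\<close>

definition shift_hat ::
  "('n::finite \<Rightarrow> 'a::euclidean_space \<Rightarrow> real) \<Rightarrow> ('n \<Rightarrow> bool) \<Rightarrow> ('n \<Rightarrow> 'a) \<Rightarrow> ('n \<Rightarrow> 'a) \<Rightarrow> 'n \<Rightarrow> 'a" where
  "shift_hat f eta x h i = of_bool (eta i) *\<^sub>R h i + (1 - of_bool (eta i)) *\<^sub>R grad (f i) (x i)"

definition iterate_hat ::
  "('n::finite \<Rightarrow> 'a::euclidean_space \<Rightarrow> real) \<Rightarrow> real \<Rightarrow> ('n \<Rightarrow> bool) \<Rightarrow> ('n \<Rightarrow> 'a) \<Rightarrow> ('n \<Rightarrow> 'a) \<Rightarrow> 'n \<Rightarrow> 'a" where
  "iterate_hat f \<gamma> eta x h i = x i - \<gamma> *\<^sub>R (grad (f i) (x i) - shift_hat f eta x h i)"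

definition iterate_next ::
  "('n::finite \<Rightarrow> 'a::euclidean_space \<Rightarrow> real) \<Rightarrow> real \<Rightarrow> real \<Rightarrow> bool \<Rightarrow> ('n \<Rightarrow> bool) \<Rightarrow>
     ('n \<Rightarrow> 'a) \<Rightarrow> ('n \<Rightarrow> 'a) \<Rightarrow> 'n \<Rightarrow> 'a" where
  "iterate_next f \<gamma> p theta eta x h i =
     (if theta then mean (\<lambda>j. iterate_hat f \<gamma> eta x h j - (\<gamma> / p) *\<^sub>R shift_hat f eta x h j)
      else iterate_hat f \<gamma> eta x h i)"

definition shift_next ::
  "('n::finite \<Rightarrow> 'a::euclidean_space \<Rightarrow> real) \<Rightarrow> real \<Rightarrow> real \<Rightarrow> bool \<Rightarrow> ('n \<Rightarrow> bool) \<Rightarrow>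
     ('n \<Rightarrow> 'a) \<Rightarrow> ('n \<Rightarrow> 'a) \<Rightarrow> 'n \<Rightarrow> 'a" where
  "shift_next f \<gamma> p theta eta x h i =
     shift_hat f eta x h i
     + (p / \<gamma>) *\<^sub>R (iterate_next f \<gamma> p theta eta x h i - iterate_hat f \<gamma> eta x h i)"

primrec gradskip ::
  "('n::finite \<Rightarrow> 'a::euclidean_space \<Rightarrow> real) \<Rightarrow> real \<Rightarrow> real \<Rightarrow> ('n \<Rightarrow> 'a) \<Rightarrow> ('n \<Rightarrow> 'a) \<Rightarrow>
     (nat \<Rightarrow> bool) \<Rightarrow> ('n \<Rightarrow> nat \<Rightarrow> bool) \<Rightarrow> nat \<Rightarrow> ('n \<Rightarrow> 'a) \<times> ('n \<Rightarrow> 'a)" where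
  "gradskip f \<gamma> p x0 h0 \<theta> \<eta> 0 = (x0, h0)"
| "gradskip f \<gamma> p x0 h0 \<theta> \<eta> (Suc t) =
     (case gradskip f \<gamma> p x0 h0 \<theta> \<eta> t of (x, h) \<Rightarrow>
        (iterate_next f \<gamma> p (\<theta> t) (\<lambda>i. \<eta> i t) x h, shift_next f \<gamma> p (\<theta> t) (\<lambda>i. \<eta> i t) x h))"

definition lyapunov ::
  "('n::finite \<Rightarrow> 'a::euclidean_space \<Rightarrow> real) \<Rightarrow> real \<Rightarrow> real \<Rightarrow> 'a \<Rightarrow> ('n \<Rightarrow> 'a) \<times> ('n \<Rightarrow> 'a) \<Rightarrow> real" where
  "lyapunov f \<gamma> p xs = (\<lambda>(x, h).
     (\<Sum>i\<in>UNIV. (norm (x i - xs))\<^sup>2)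
     + \<gamma>\<^sup>2 / p\<^sup>2 * (\<Sum>i\<in>UNIV. (norm (h i - grad (f i) xs))\<^sup>2))"

definition admissible_stepsize ::
  "('n::finite \<Rightarrow> real) \<Rightarrow> real \<Rightarrow> ('n \<Rightarrow> real) \<Rightarrow> real \<Rightarrow> bool" where
  "admissible_stepsize L p q \<gamma> \<longleftrightarrow>
     0 < \<gamma> \<and> \<gamma> \<le> Min (range (\<lambda>i. 1 / L i * (p\<^sup>2 / (1 - q i * (1 - p\<^sup>2)))))"

text \<open>All coins are jointly independent: the family is indexed by the sum type \<open>nat + 'n \<times> nat\<close>,
  whose left summand carries the coins \<open>\<theta>\<close> and whose right summand carries the coins \<open>\<eta>\<close>.\<close>

definition gradskip_coins ::
  "'w measure \<Rightarrow> real \<Rightarrow> ('n::finite \<Rightarrow> real) \<Rightarrow> (nat \<Rightarrow> 'w \<Rightarrow> bool) \<Rightarrow> ('n \<Rightarrow> nat \<Rightarrow> 'w \<Rightarrow> bool) \<Rightarrow> bool" where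
  "gradskip_coins M p q \<theta> \<eta> \<longleftrightarrow>
     prob_space M
     \<and> prob_space.indep_vars M (\<lambda>_. count_space UNIV)
          (case_sum \<theta> (\<lambda>(i, t). \<eta> i t)) (UNIV :: (nat + 'n \<times> nat) set)
     \<and> (\<forall>t. measure M {\<omega> \<in> space M. \<theta> t \<omega>} = p)
     \<and> (\<forall>i t. measure M {\<omega> \<in> space M. \<eta> i t \<omega>} = q i)"

text \<open>Number of tosses from time \<open>s\<close> on, up to and including the first one at which \<open>P\<close> holds. It is
  \<open>\<infinity>\<close> if this never happens (an infimum over the empty set), in particular if \<open>s = \<infinity>\<close>.\<close>

definition tosses_until :: "(nat \<Rightarrow> bool) \<Rightarrow> enat \<Rightarrow> enat" where
  "tosses_until P s = (INF t\<in>{t. s \<le> enat t \<and> P t}. enat (Suc t) - s)"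

text \<open>First iteration of the communication round number \<open>r\<close>, counted from 0; it is \<open>\<infinity>\<close> if there
  are fewer than \<open>r\<close> communications.\<close>

primrec round_start :: "(nat \<Rightarrow> bool) \<Rightarrow> nat \<Rightarrow> enat" where
  "round_start \<theta> 0 = 0"
| "round_start \<theta> (Suc r) = round_start \<theta> r + tosses_until \<theta> (round_start \<theta> r)"

definition local_gradients :: "(nat \<Rightarrow> bool) \<Rightarrow> (nat \<Rightarrow> bool) \<Rightarrow> nat \<Rightarrow> enat" where
  "local_gradients \<theta> eta r =
     min (tosses_until \<theta> (round_start \<theta> r)) (tosses_until (\<lambda>t. \<not> eta t) (round_start \<theta> r))"

end

theory Submission
  imports Defs
begin

text \<open>
  Let \<open>a i\<close> and \<open>b i\<close> be the errors of the intermediate iterate and of the intermediate shift, the latter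
  scaled by \<open>\<gamma> / p\<close>. A communication turns the Lyapunov function into the sum of the \<open>(norm (a i - b i))\<^sup>2\<close>,
  no communication leaves \<open>(norm (a i))\<^sup>2 + (norm (b i))\<^sup>2\<close>; averaging over the coin gives
  \<open>(norm (a i - p *\<^sub>R b i))\<^sup>2 + (1 - p\<^sup>2) * (norm (b i))\<^sup>2\<close>, whose first term is the error of a plain
  gradient step and no longer involves \<open>\<eta>\<close>. Averaging the second term over \<open>\<eta>\<close>, cocoercivity of the
  gradients absorbs the gradient differences, and the Lyapunov function contracts by the factor
  \<open>1 - 1 / \<kappa>max\<close> in expectation.

  The start \<open>s\<close> of a round is determined by the coins before \<open>s\<close>. Hence, given \<open>s\<close>, the number of local
  gradients exceeds \<open>k\<close> with probability \<open>(q i * (1 - p)) ^ k\<close>, and its expectation is a geometric series.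
\<close>

section \<open>Smooth strongly convex functions\<close>

text \<open>By the three-point identity, moving the first argument of \<open>bregman g _ y\<close>
  from \<open>x\<close> to \<open>z\<close> changes it by
  \<open>D \<bullet> (z - x) + bregman g z x\<close>. The step to \<open>z\<close> minimizes the
  quadratic upper bound of this change and gains \<open>(norm D)\<^sup>2 / (2 * L)\<close>;
  nonnegativity at \<open>z\<close> caps that gain by \<open>bregman g x y\<close>.\<close>

lemma norm_grad_diff_le_bregman:
  assumes nonneg: "\<And>x y. 0 \<le> bregman g x y"
    and upper: "\<And>x y. bregman g x y \<le> L / 2 * (norm (x - y))\<^sup>2" and L: "L > 0"
  shows "(norm (grad g x - grad g y))\<^sup>2 \<le> 2 * L * bregman g x y"
proof -
  define D where "D = grad g x - grad g y"
  define z where "z = x - (1 / L) *\<^sub>R D"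
  have "0 \<le> bregman g z y" by (rule nonneg)
  also have "bregman g z y = bregman g z x + bregman g x y + D \<bullet> (z - x)"
    by (simp add: bregman_def D_def inner_diff_left inner_diff_right)
  also have "D \<bullet> (z - x) = - (norm D)\<^sup>2 / L"
    by (simp add: z_def power2_norm_eq_inner)
  also have "bregman g z x \<le> L / 2 * (norm (z - x))\<^sup>2" by (rule upper)
  also have "(norm (z - x))\<^sup>2 = (norm D)\<^sup>2 / L\<^sup>2"
    using L by (simp add: z_def power_divide)
  finally show ?thesis
    using L by (simp add: D_def field_simps power2_eq_square)
qed

text \<open>The symmetrized Bregman divergence is the inner product \<open>B\<close>, so
  \<open>B\<close> dominates both \<open>\<mu> * N\<close> (strong monotonicity) and
  \<open>D / L\<close> (cocoercivity). Of the term \<open>2 * \<gamma> * B\<close>, one half pays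
  for \<open>c * D\<close> and the other half yields the contraction.\<close>

lemma gradient_step_bound:
  assumes lower: "\<And>x y. \<mu> / 2 * (norm (x - y))\<^sup>2 \<le> bregman g x y"
    and upper: "\<And>x y. bregman g x y \<le> L / 2 * (norm (x - y))\<^sup>2"
    and "0 < L" "0 \<le> \<mu>" "0 \<le> \<gamma>" and c: "c \<le> \<gamma> / L"
  shows "(norm (x - y))\<^sup>2 - 2 * \<gamma> * ((x - y) \<bullet> (grad g x - grad g y))
           + c * (norm (grad g x - grad g y))\<^sup>2
         \<le> (1 - \<gamma> * \<mu>) * (norm (x - y))\<^sup>2"
proof -
  define D N B where "D = (norm (grad g x - grad g y))\<^sup>2" and "N = (norm (x - y))\<^sup>2"
    and "B = (x - y) \<bullet> (grad g x - grad g y)"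
  have nonneg: "0 \<le> bregman g u v" for u v
    using lower[of u v] \<open>0 \<le> \<mu>\<close> by (meson order_trans mult_nonneg_nonneg divide_nonneg_nonneg zero_le_numeral zero_le_power2)
  have sym: "bregman g x y + bregman g y x = B"
    by (simp add: bregman_def B_def inner_diff_left inner_diff_right inner_commute)
  have "\<mu> * N \<le> B"
    using sym lower[of x y] lower[of y x] by (simp add: N_def norm_minus_commute)
  have "D \<le> L * B"
    using norm_grad_diff_le_bregman[OF nonneg upper \<open>0 < L\<close>, of x y]
      norm_grad_diff_le_bregman[OF nonneg upper \<open>0 < L\<close>, of y x] sym
    by (simp add: D_def norm_minus_commute algebra_simps flip: sym)
  have "c * D \<le> \<gamma> / L * D" using c unfolding D_def by (intro mult_right_mono) auto
  also have "\<dots> \<le> \<gamma> / L * (L * B)"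
    using \<open>D \<le> L * B\<close> assms(3,5) by (intro mult_left_mono) auto
  also have "\<dots> = \<gamma> * B" using \<open>0 < L\<close> by simp
  finally have "c * D \<le> \<gamma> * B" .
  moreover have "\<gamma> * (\<mu> * N) \<le> \<gamma> * B" using \<open>\<mu> * N \<le> B\<close> assms(5) by (rule mult_left_mono)
  ultimately show ?thesis
    unfolding D_def[symmetric] N_def[symmetric] B_def[symmetric] by (simp add: left_diff_distrib)
qed

text \<open>At \<open>xs\<close> the sum of the \<open>f i\<close> has a quadratic upper model with
  slope \<open>G\<close> and curvature \<open>S\<close>. The step to \<open>y\<close> would lower
  the sum by at least \<open>(norm G)\<^sup>2 / (2 * S)\<close>, which minimality forbids unless
  \<open>G = 0\<close>.\<close>

lemma sum_grad_minimizer: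
  fixes f :: "'n::finite \<Rightarrow> 'a::euclidean_space \<Rightarrow> real"
  assumes upper: "\<And>i x y. bregman (f i) x y \<le> L i / 2 * (norm (x - y))\<^sup>2"
    and L: "\<And>i. 0 < L i"
    and min: "\<And>y. mean (\<lambda>i. f i xs) \<le> mean (\<lambda>i. f i y)"
  shows "(\<Sum>i\<in>UNIV. grad (f i) xs) = 0"
proof -
  define G S where "G = (\<Sum>i\<in>UNIV. grad (f i) xs)" and "S = sum L UNIV"
  have S: "S > 0" unfolding S_def by (intro sum_pos) (auto simp: L)
  define y where "y = xs - (1 / S) *\<^sub>R G"
  have n: "norm (y - xs) = norm G / S" using S by (simp add: y_def)
  have "(\<Sum>i\<in>UNIV. f i xs) \<le> (\<Sum>i\<in>UNIV. f i y)"
    using min[of y] by (simp add: mean_def divide_right_mono divide_le_cancel)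
  also have "(\<Sum>i\<in>UNIV. f i y) = (\<Sum>i\<in>UNIV. f i xs) + G \<bullet> (y - xs) + (\<Sum>i\<in>UNIV. bregman (f i) y xs)"
    by (simp add: bregman_def G_def sum.distrib sum_subtractf inner_sum_left)
  also have "(\<Sum>i\<in>UNIV. bregman (f i) y xs) \<le> (\<Sum>i\<in>UNIV. L i / 2 * (norm (y - xs))\<^sup>2)"
    by (intro sum_mono upper)
  also have "\<dots> = S / 2 * (norm (y - xs))\<^sup>2"
    by (simp add: S_def sum_distrib_right sum_divide_distrib)
  finally have "0 \<le> G \<bullet> (y - xs) + S / 2 * (norm (y - xs))\<^sup>2" by simp
  also have "\<dots> = - (norm G)\<^sup>2 / (2 * S)"
    unfolding n using S by (simp add: y_def field_simps power2_eq_square flip: power2_norm_eq_inner)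
  finally have "(norm G)\<^sup>2 \<le> 0" using S by (simp add: field_simps)
  then show ?thesis by (simp add: G_def)
qed

text \<open>Pythagoras: the deviations \<open>u i - mean u\<close> sum to 0, hence form a family
  orthogonal to the constant family \<open>mean u\<close>.\<close>

lemma sum_norm_mean_decomp:
  fixes u :: "'n::finite \<Rightarrow> 'a::euclidean_space"
  shows "(\<Sum>i\<in>UNIV. (norm (mean u))\<^sup>2 + (norm (mean u - u i))\<^sup>2) = (\<Sum>i\<in>UNIV. (norm (u i))\<^sup>2)"
proof -
  have "(\<Sum>i\<in>UNIV. u i) = real CARD('n) *\<^sub>R mean u"
    by (simp add: mean_def)
  then have "(\<Sum>i\<in>UNIV. mean u \<bullet> u i) = real CARD('n) * (mean u \<bullet> mean u)"
    by (simp flip: inner_sum_right)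
  then show ?thesis
    by (simp add: power2_norm_eq_inner inner_diff_left inner_diff_right inner_commute
        sum.distrib sum_subtractf flip: sum_distrib_left)
qed

section \<open>One step of GradSkip\<close>

lemma norm_diff_sq:
  fixes a b :: "'a::real_inner"
  shows "(norm (a - b))\<^sup>2 = (norm a)\<^sup>2 - 2 * (a \<bullet> b) + (norm b)\<^sup>2"
  by (simp add: power2_norm_eq_inner inner_diff_left inner_diff_right inner_commute)

lemma lyapunov_eq_sum:
  "lyapunov f \<gamma> p xs (x, h)
    = (\<Sum>i\<in>UNIV. (norm (x i - xs))\<^sup>2 + \<gamma>\<^sup>2 / p\<^sup>2 * (norm (h i - grad (f i) xs))\<^sup>2)"
  by (simp add: lyapunov_def sum_distrib_left sum.distrib)

text \<open>The communication step is the orthogonal projection of the family \<open>x i - (\<gamma> / p) *\<^sub>R h i\<close> onto the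
  constant families, and \<open>xs\<close> is the projection of \<open>xs - (\<gamma> / p) *\<^sub>R grad (f i) xs\<close> because the gradients
  at the minimizer sum to 0. The new iterate error and the new shift error are the two orthogonal components,
  so Pythagoras applies.\<close>
lemma lyapunov_next_True:
  fixes f :: "'n::finite \<Rightarrow> 'a::euclidean_space \<Rightarrow> real"
  assumes opt: "(\<Sum>i\<in>UNIV. grad (f i) xs) = 0" and "p > 0" "\<gamma> > 0"
  shows "lyapunov f \<gamma> p xs (iterate_next f \<gamma> p True e x h, shift_next f \<gamma> p True e x h)
    = (\<Sum>i\<in>UNIV. (norm (iterate_hat f \<gamma> e x h i - xs - (\<gamma> / p) *\<^sub>R (shift_hat f e x h i - grad (f i) xs)))\<^sup>2)"
proof -
  define u where "u i = iterate_hat f \<gamma> e x h i - xs - (\<gamma> / p) *\<^sub>R (shift_hat f e x h i - grad (f i) xs)" for i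
  define v where "v = mean (\<lambda>i. iterate_hat f \<gamma> e x h i - (\<gamma> / p) *\<^sub>R shift_hat f e x h i)"
  have mean_u: "mean u = v - xs"
    using opt by (simp add: mean_def u_def v_def sum.distrib sum_subtractf scaleR_diff_right
        scaleR_right_distrib sum_constant_scaleR flip: scaleR_sum_right)
  have shift: "\<gamma>\<^sup>2 / p\<^sup>2 * (norm (shift_next f \<gamma> p True e x h i - grad (f i) xs))\<^sup>2 = (norm (mean u - u i))\<^sup>2" for i
  proof -
    have "mean u - u i = (\<gamma> / p) *\<^sub>R (shift_next f \<gamma> p True e x h i - grad (f i) xs)"
      using assms unfolding mean_u
      by (simp add: u_def v_def[symmetric] shift_next_def iterate_next_def algebra_simps)
    then show ?thesis using assms by (simp add: power_mult_distrib power_divide)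
  qed
  have "lyapunov f \<gamma> p xs (iterate_next f \<gamma> p True e x h, shift_next f \<gamma> p True e x h)
      = (\<Sum>i\<in>UNIV. (norm (mean u))\<^sup>2 + (norm (mean u - u i))\<^sup>2)"
    unfolding lyapunov_eq_sum shift by (simp add: iterate_next_def mean_u v_def)
  then show ?thesis
    by (simp add: sum_norm_mean_decomp) (simp add: u_def)
qed

text \<open>Averages over the communication coin only. In the resulting sum client \<open>i\<close>
  sees nothing but its own coin \<open>e i\<close>, so the remaining coins can be averaged one
  client at a time.\<close>

lemma lyapunov_next_mixture:
  fixes f :: "'n::finite \<Rightarrow> 'a::euclidean_space \<Rightarrow> real"
  assumes opt: "(\<Sum>i\<in>UNIV. grad (f i) xs) = 0" and "p > 0" "\<gamma> > 0"
  shows "p * lyapunov f \<gamma> p xs (iterate_next f \<gamma> p True e x h, shift_next f \<gamma> p True e x h)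
     + (1 - p) * lyapunov f \<gamma> p xs (iterate_next f \<gamma> p False e x h, shift_next f \<gamma> p False e x h)
   = (\<Sum>i\<in>UNIV. (norm (x i - xs - \<gamma> *\<^sub>R (grad (f i) (x i) - grad (f i) xs)))\<^sup>2
       + (1 - p\<^sup>2) * (\<gamma>\<^sup>2 / p\<^sup>2) *
         (if e i then (norm (h i - grad (f i) xs))\<^sup>2 else (norm (grad (f i) (x i) - grad (f i) xs))\<^sup>2))"
proof -
  define a b where "a i = iterate_hat f \<gamma> e x h i - xs"
    and "b i = (\<gamma> / p) *\<^sub>R (shift_hat f e x h i - grad (f i) xs)" for i
  have nb: "(norm (b i))\<^sup>2 = \<gamma>\<^sup>2 / p\<^sup>2 * (norm (shift_hat f e x h i - grad (f i) xs))\<^sup>2" for i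
    using assms by (simp add: b_def power_mult_distrib power_divide)
  \<comment> \<open>Both sides expand to \<open>(norm a)\<^sup>2 - 2 * p * (a \<bullet> b) + (norm
    b)\<^sup>2\<close>; the right side completes the square.\<close>
  have mix: "p * (norm (a - b))\<^sup>2 + (1 - p) * ((norm a)\<^sup>2 + (norm b)\<^sup>2)
      = (norm (a - p *\<^sub>R b))\<^sup>2 + (1 - p\<^sup>2) * (norm b)\<^sup>2" for a b :: 'a
    by (simp add: norm_diff_sq power_mult_distrib) (simp add: algebra_simps power2_eq_square)
  \<comment> \<open>The hat shift enters \<open>a i\<close> with weight \<open>\<gamma>\<close> and
    \<open>p *\<^sub>R b i\<close> with the same weight, so it cancels, and the coin
    \<open>e i\<close> with it.\<close>
  have ab: "a i - p *\<^sub>R b i = x i - xs - \<gamma> *\<^sub>R (grad (f i) (x i) - grad (f i) xs)" for i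
    using assms by (simp add: a_def b_def iterate_hat_def algebra_simps)
  have no_comm: "lyapunov f \<gamma> p xs (iterate_next f \<gamma> p False e x h, shift_next f \<gamma> p False e x h)
     = (\<Sum>i\<in>UNIV. (norm (a i))\<^sup>2 + (norm (b i))\<^sup>2)"
    by (simp add: lyapunov_eq_sum nb iterate_next_def shift_next_def a_def)
  have comm: "lyapunov f \<gamma> p xs (iterate_next f \<gamma> p True e x h, shift_next f \<gamma> p True e x h)
     = (\<Sum>i\<in>UNIV. (norm (a i - b i))\<^sup>2)"
    using assms by (simp add: lyapunov_next_True a_def b_def)
  have hat: "(norm (shift_hat f e x h i - grad (f i) xs))\<^sup>2 =
     (if e i then (norm (h i - grad (f i) xs))\<^sup>2 else (norm (grad (f i) (x i) - grad (f i) xs))\<^sup>2)" for i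
    by (simp add: shift_hat_def)
  show ?thesis
    unfolding comm no_comm sum_distrib_left sum.distrib[symmetric] mix
    unfolding ab nb hat mult.assoc ..
qed

text \<open>The left side is the mixture over \<open>\<theta>\<close> with each
  \<open>if e i\<close> replaced by its average. The estimate holds client by client:
  \<open>step\<close> lets cocoercivity absorb the gradient differences, and \<open>rate\<close>
  makes the iterate part and the shift part contract by a common factor.\<close>

lemma lyapunov_contraction:
  fixes f :: "'n::finite \<Rightarrow> 'a::euclidean_space \<Rightarrow> real"
  assumes lower: "\<And>i x y. \<mu> / 2 * (norm (x - y))\<^sup>2 \<le> bregman (f i) x y"
    and upper: "\<And>i x y. bregman (f i) x y \<le> L i / 2 * (norm (x - y))\<^sup>2"
    and "\<And>i. 0 < L i" "0 \<le> \<mu>" "0 < \<gamma>" "0 < p"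
    and step: "\<And>i. \<gamma> * L i * (1 - q i * (1 - p\<^sup>2)) \<le> p\<^sup>2"
    and rate: "\<rho> \<le> \<gamma> * \<mu>" "\<And>i. q i * (1 - p\<^sup>2) \<le> 1 - \<rho>"
  shows "(\<Sum>i\<in>UNIV. (norm (x i - xs - \<gamma> *\<^sub>R (grad (f i) (x i) - grad (f i) xs)))\<^sup>2
       + (1 - p\<^sup>2) * (\<gamma>\<^sup>2 / p\<^sup>2) * (q i * (norm (h i - grad (f i) xs))\<^sup>2
         + (1 - q i) * (norm (grad (f i) (x i) - grad (f i) xs))\<^sup>2))
    \<le> (1 - \<rho>) * lyapunov f \<gamma> p xs (x, h)"
proof -
  have "(norm (x i - xs - \<gamma> *\<^sub>R (grad (f i) (x i) - grad (f i) xs)))\<^sup>2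
       + (1 - p\<^sup>2) * (\<gamma>\<^sup>2 / p\<^sup>2) * (q i * (norm (h i - grad (f i) xs))\<^sup>2
         + (1 - q i) * (norm (grad (f i) (x i) - grad (f i) xs))\<^sup>2)
      \<le> (1 - \<rho>) * ((norm (x i - xs))\<^sup>2 + \<gamma>\<^sup>2 / p\<^sup>2 * (norm (h i - grad (f i) xs))\<^sup>2)" for i
  proof -
    define N B G H Q k where "N = (norm (x i - xs))\<^sup>2"
      and "B = (x i - xs) \<bullet> (grad (f i) (x i) - grad (f i) xs)"
      and "G = (norm (grad (f i) (x i) - grad (f i) xs))\<^sup>2"
      and "H = (norm (h i - grad (f i) xs))\<^sup>2"
      and "Q = (norm (x i - xs - \<gamma> *\<^sub>R (grad (f i) (x i) - grad (f i) xs)))\<^sup>2"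
      and "k = \<gamma>\<^sup>2 / p\<^sup>2"
    \<comment> \<open>The total weight of \<open>G\<close>: \<open>\<gamma>\<^sup>2\<close> from
      expanding \<open>Q\<close> plus \<open>(1 - p\<^sup>2) * k * (1 - q i)\<close> from the
      refreshed shift.\<close>
    define c where "c = k * (1 - q i * (1 - p\<^sup>2))"
    have "\<gamma> * (\<gamma> * L i * (1 - q i * (1 - p\<^sup>2))) \<le> \<gamma> * p\<^sup>2"
      using step[of i] \<open>0 < \<gamma>\<close> by simp
    then have "c \<le> \<gamma> / L i"
      using assms(3)[of i] \<open>0 < p\<close> by (simp add: c_def k_def field_simps power2_eq_square)
    then have "N - 2 * \<gamma> * B + c * G \<le> (1 - \<gamma> * \<mu>) * N"
      unfolding N_def B_def G_def using assms by (intro gradient_step_bound) auto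
    also have "\<dots> \<le> (1 - \<rho>) * N"
      using rate(1) unfolding N_def by (intro mult_right_mono) auto
    finally have "N - 2 * \<gamma> * B + c * G \<le> (1 - \<rho>) * N" .
    moreover have "q i * (1 - p\<^sup>2) * (k * H) \<le> (1 - \<rho>) * (k * H)"
      using rate(2) by (intro mult_right_mono) (auto simp: H_def k_def)
    moreover have "Q = N - 2 * \<gamma> * B + \<gamma>\<^sup>2 * G"
      unfolding Q_def N_def B_def G_def by (simp add: norm_diff_sq power_mult_distrib)
    moreover have "\<gamma>\<^sup>2 * G + (1 - p\<^sup>2) * k * ((1 - q i) * G) = c * G"
      using \<open>0 < p\<close> by (simp add: c_def k_def field_simps)
    ultimately show ?thesis
      unfolding N_def[symmetric] H_def[symmetric] G_def[symmetric] Q_def[symmetric] k_def[symmetric]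
      by (simp add: algebra_simps)
  qed
  then show ?thesis
    unfolding lyapunov_eq_sum sum_distrib_left by (intro sum_mono)
qed

section \<open>Independent coins\<close>

text \<open>All expectations reduce to functions of finitely many coins, which are automatically bounded and
  measurable.\<close>

definition depends_on :: "'i set \<Rightarrow> (('i \<Rightarrow> bool) \<Rightarrow> 'b) \<Rightarrow> bool" where
  "depends_on A F \<longleftrightarrow> (\<forall>c c'. (\<forall>a\<in>A. c a = c' a) \<longrightarrow> F c = F c')"

lemma depends_on_mono: "depends_on A F \<Longrightarrow> A \<subseteq> B \<Longrightarrow> depends_on B F"
  unfolding depends_on_def by blast

lemma depends_on_restrict: "depends_on A F \<Longrightarrow> F (restrict c A) = F c"
  unfolding depends_on_def by (metis restrict_apply')

lemma depends_on_comp: "depends_on A F \<Longrightarrow> depends_on A (\<lambda>c. g (F c))"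
  unfolding depends_on_def by metis

lemma depends_on_If:
  assumes "depends_on A F" "depends_on A G" "j \<in> A"
  shows "depends_on A (\<lambda>c. if c j then F c else G c)"
  unfolding depends_on_def
proof (intro allI impI)
  fix c c' :: "'a \<Rightarrow> bool"
  assume *: "\<forall>a\<in>A. c a = c' a"
  then have "F c = F c'" "G c = G c'" using assms(1,2) unfolding depends_on_def by blast+
  with * assms(3) show "(if c j then F c else G c) = (if c' j then F c' else G c')" by simp
qed

locale coins = prob_space M for M :: "'w measure" +
  fixes X :: "'i \<Rightarrow> 'w \<Rightarrow> bool"
  assumes indep: "indep_vars (\<lambda>_. count_space UNIV) X UNIV"
begin

lemma coin_measurable [measurable]: "X a \<in> measurable M (count_space UNIV)"
  using indep by (auto simp: indep_vars_def)

text \<open>A finite product of discrete coin spaces is discrete, so every function on it is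
  measurable.\<close>

lemma restrict_coins_measurable:
  assumes "finite A"
  shows "(\<lambda>\<omega>. restrict (\<lambda>a. X a \<omega>) A) \<in> measurable M (count_space (PiE A (\<lambda>_. UNIV)))"
proof -
  have "(\<lambda>\<omega>. restrict (\<lambda>a. X a \<omega>) A) \<in> measurable M (PiM A (\<lambda>_. count_space UNIV))"
    by (intro measurable_restrict coin_measurable)
  then show ?thesis using assms by (simp add: count_space_PiM_finite)
qed

lemma measurable_coins:
  assumes "finite A" "depends_on A F" "\<And>c. F c \<in> space N"
  shows "(\<lambda>\<omega>. F (\<lambda>a. X a \<omega>)) \<in> measurable M N"
proof -
  have "F \<in> measurable (count_space (PiE A (\<lambda>_. UNIV))) N"
    using assms by (simp add: measurable_count_space_eq1)
  from measurable_compose[OF restrict_coins_measurable[OF assms(1)] this]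
  show ?thesis using assms(2) by (simp add: depends_on_restrict)
qed

lemma integrable_coins:
  fixes F :: "('i \<Rightarrow> bool) \<Rightarrow> real"
  assumes "finite A" "depends_on A F"
  shows "integrable M (\<lambda>\<omega>. F (\<lambda>a. X a \<omega>))"
proof -
  have "finite (F ` PiE A (\<lambda>_. UNIV))" using assms(1) by (intro finite_imageI finite_PiE) auto
  then obtain B where B: "\<And>c. c \<in> PiE A (\<lambda>_. UNIV) \<Longrightarrow> \<bar>F c\<bar> \<le> B"
    using bounded_iff finite_imp_bounded by (metis imageI real_norm_def)
  have "\<bar>F c\<bar> \<le> B" for c
    using B[of "restrict c A"] assms(2) by (simp add: depends_on_restrict)
  moreover have "(\<lambda>\<omega>. F (\<lambda>a. X a \<omega>)) \<in> borel_measurable M"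
    using assms by (intro measurable_coins) auto
  ultimately show ?thesis by (intro integrable_const_bound[where B=B]) auto
qed

lemma expectation_coin_times:
  fixes F :: "('i \<Rightarrow> bool) \<Rightarrow> real"
  assumes "finite A" "depends_on A F" "j \<notin> A"
  shows "expectation (\<lambda>\<omega>. of_bool (X j \<omega>) * F (\<lambda>a. X a \<omega>))
    = \<P>(\<omega> in M. X j \<omega>) * expectation (\<lambda>\<omega>. F (\<lambda>a. X a \<omega>))"
proof -
  have "indep_var (PiM {j} (\<lambda>_. count_space UNIV)) (\<lambda>\<omega>. restrict (\<lambda>i. X i \<omega>) {j})
      (PiM A (\<lambda>_. count_space UNIV)) (\<lambda>\<omega>. restrict (\<lambda>i. X i \<omega>) A)"
    using indep assms(3) by (intro indep_var_restrict) auto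
  then have "indep_var borel ((\<lambda>c. of_bool (c j) :: real) \<circ> (\<lambda>\<omega>. restrict (\<lambda>i. X i \<omega>) {j}))
     borel (F \<circ> (\<lambda>\<omega>. restrict (\<lambda>i. X i \<omega>) A))"
    using assms(1) by (intro indep_var_compose) (auto simp: count_space_PiM_finite)
  then have "indep_var borel (\<lambda>\<omega>. of_bool (X j \<omega>) :: real) borel (\<lambda>\<omega>. F (\<lambda>a. X a \<omega>))"
    using assms(2) by (simp add: o_def depends_on_restrict)
  moreover have "integrable M (\<lambda>\<omega>. of_bool (X j \<omega>) :: real)"
    by (rule integrable_coins[of "{j}"]) (auto simp: depends_on_def)
  moreover have "expectation (\<lambda>\<omega>. of_bool (X j \<omega>) :: real) = \<P>(\<omega> in M. X j \<omega>)"
    by (subst Bochner_Integration.integral_cong[where g="indicator {\<omega> \<in> space M. X j \<omega>}"]) (auto simp: indicator_def)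
  ultimately show ?thesis
    using integrable_coins[OF assms(1,2)] by (simp add: indep_var_lebesgue_integral)
qed

text \<open>Takes the place of conditioning on all coins but \<open>j\<close>: as neither branch
  reads coin \<open>j\<close>, the case distinction may be replaced by its average. Writing the case
  distinction with \<open>of_bool\<close> reduces this to products of independent factors.\<close>

lemma expectation_coin_cases:
  fixes F G :: "('i \<Rightarrow> bool) \<Rightarrow> real"
  assumes "finite A" "depends_on A F" "depends_on A G" "j \<notin> A" and r: "\<P>(\<omega> in M. X j \<omega>) = r"
  shows "expectation (\<lambda>\<omega>. if X j \<omega> then F (\<lambda>a. X a \<omega>) else G (\<lambda>a. X a \<omega>))
    = expectation (\<lambda>\<omega>. r * F (\<lambda>a. X a \<omega>) + (1 - r) * G (\<lambda>a. X a \<omega>))"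
proof -
  let ?F = "\<lambda>\<omega>. F (\<lambda>a. X a \<omega>)" and ?G = "\<lambda>\<omega>. G (\<lambda>a. X a \<omega>)"
  note int = integrable_coins[OF assms(1,2)] integrable_coins[OF assms(1,3)]
  have dep: "depends_on (insert j A) (\<lambda>c. of_bool (c j) * H c)" if "depends_on A H" for H :: "('i \<Rightarrow> bool) \<Rightarrow> real"
    using that by (auto simp: depends_on_def)
  have "integrable M (\<lambda>\<omega>. of_bool (X j \<omega>) * ?F \<omega>)" "integrable M (\<lambda>\<omega>. of_bool (X j \<omega>) * ?G \<omega>)"
    using integrable_coins[OF _ dep] assms(1-3) by auto
  then have "expectation (\<lambda>\<omega>. of_bool (X j \<omega>) * ?F \<omega> + ?G \<omega> - of_bool (X j \<omega>) * ?G \<omega>)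
     = r * expectation ?F + expectation ?G - r * expectation ?G"
    using int assms by (simp add: expectation_coin_times)
  also have "\<dots> = expectation (\<lambda>\<omega>. r * ?F \<omega> + (1 - r) * ?G \<omega>)"
    using int by (simp add: algebra_simps)
  moreover have "(\<lambda>\<omega>. if X j \<omega> then ?F \<omega> else ?G \<omega>)
      = (\<lambda>\<omega>. of_bool (X j \<omega>) * ?F \<omega> + ?G \<omega> - of_bool (X j \<omega>) * ?G \<omega>)"
    by auto
  ultimately show ?thesis by simp
qed

end

section \<open>Communication rounds\<close>

text \<open>Tail events are the convenient form of a waiting time: they read finitely many coins and
  treat \<open>\<infinity>\<close> uniformly. The successful toss is itself counted, so exceeding
  \<open>k\<close> means \<open>k\<close> failures, at the times \<open>s\<close> to
  \<open>s + k - 1\<close>.\<close>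

lemma less_tosses_until: "enat k < tosses_until P (enat s) \<longleftrightarrow> (\<forall>t\<in>{s..<s + k}. \<not> P t)"
proof -
  have "enat k < tosses_until P (enat s) \<longleftrightarrow> (\<forall>t. s \<le> t \<and> P t \<longrightarrow> Suc k \<le> Suc t - s)"
    \<comment> \<open>The strict bound becomes a non-strict one, which an infimum satisfies exactly
      if all members do.\<close>
    unfolding tosses_until_def Suc_ile_eq[symmetric] le_INF_iff by auto
  also have "\<dots> \<longleftrightarrow> (\<forall>t\<in>{s..<s + k}. \<not> P t)"
  proof (intro iffI allI ballI impI notI)
    fix t assume *: "\<forall>t\<in>{s..<s + k}. \<not> P t" "s \<le> t \<and> P t"
    then have "\<not> t < s + k" by auto
    with * show "Suc k \<le> Suc t - s" by auto
  qed fastforce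
  finally show ?thesis .
qed

lemma tosses_until_infinity [simp]: "tosses_until P \<infinity> = \<infinity>"
  by (simp add: tosses_until_def top_enat_def)

text \<open>Reduces point events to tail events, where \<open>less_tosses_until\<close>
  applies.\<close>

lemma eq_enat_iff: "z = enat m \<longleftrightarrow> (\<forall>k<m. enat k < z) \<and> \<not> enat m < z"
proof (cases z)
  case (enat j)
  then show ?thesis by (metis enat_ord_simps(2) enat.inject linorder_neqE_nat less_irrefl)
qed auto

lemma measurable_enatI:
  assumes [measurable]: "\<And>k. Measurable.pred M (\<lambda>\<omega>. enat k < f \<omega>)"
  shows "f \<in> measurable M (count_space UNIV)"
proof -
  have "{\<omega> \<in> space M. f \<omega> = a} \<in> sets M" for a
  proof (cases a)
    case (enat m)
    have "{\<omega> \<in> space M. (\<forall>k<m. enat k < f \<omega>) \<and> \<not> enat m < f \<omega>} \<in> sets M" by measurable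
    then show ?thesis by (simp only: enat eq_enat_iff)
  next
    case infinity
    have *: "z = \<infinity> \<longleftrightarrow> (\<forall>k. enat k < z)" for z by (cases z) auto
    have "{\<omega> \<in> space M. \<forall>k. enat k < f \<omega>} \<in> sets M" by measurable
    then show ?thesis by (simp only: infinity *)
  qed
  moreover have "f -` {a} \<inter> space M = {\<omega> \<in> space M. f \<omega> = a}" for a by auto
  ultimately show ?thesis by (simp add: measurable_count_space_eq2_countable)
qed

text \<open>The start of a round is a stopping time. If round \<open>r\<close> starts at
  \<open>s'\<close> and lasts \<open>m\<close> tosses with \<open>s' + m = s\<close>, then its start
  and its length both read only coins before \<open>s\<close>.\<close>

lemma round_start_cong:
  assumes "\<forall>t<s. \<theta> t = \<theta>' t"
  shows "round_start \<theta> r = enat s \<longleftrightarrow> round_start \<theta>' r = enat s"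
  using assms
proof (induction r arbitrary: s)
  case (Suc r)
  have *: "round_start \<theta> (Suc r) = enat s \<longleftrightarrow>
    (\<exists>s' m. s' + m = s \<and> round_start \<theta> r = enat s' \<and> tosses_until \<theta> (enat s') = enat m)" for \<theta>
    by (cases "round_start \<theta> r"; cases "tosses_until \<theta> (round_start \<theta> r)") auto
  have "tosses_until \<theta> (enat s') = enat m \<longleftrightarrow> tosses_until \<theta>' (enat s') = enat m"
    if "s' + m = s" for s' m
    unfolding eq_enat_iff[of "tosses_until _ _"] less_tosses_until using Suc.prems that by auto
  moreover have "round_start \<theta> r = enat s' \<longleftrightarrow> round_start \<theta>' r = enat s'" if "s' + m = s" for s' m
    using Suc.IH[of s'] Suc.prems that by auto
  ultimately show ?case unfolding * by blast
qed simp

lemma round_start_finite: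
  assumes "\<And>s. \<exists>t\<ge>s. \<theta> t"
  shows "round_start \<theta> r \<noteq> \<infinity>"
proof (induction r)
  case (Suc r)
  then obtain s where s: "round_start \<theta> r = enat s" by auto
  obtain t where "t \<ge> s" "\<theta> t" using assms by blast
  then have "\<not> enat (Suc t - s) < tosses_until \<theta> (enat s)"
    unfolding less_tosses_until by auto
  then have "tosses_until \<theta> (enat s) \<noteq> \<infinity>"
    by (metis enat_ord_simps(4) enat.distinct(2))
  then show ?case using s by (simp add: plus_eq_infty_iff_enat)
qed (simp add: zero_enat_def)

lemma less_local_gradients:
  assumes "round_start \<theta> r = enat s"
  shows "enat k < local_gradients \<theta> \<eta> r \<longleftrightarrow> (\<forall>t\<in>{s..<s + k}. \<not> \<theta> t \<and> \<eta> t)"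
  unfolding local_gradients_def assms by (auto simp: less_tosses_until)

section \<open>Expected decay and number of communications\<close>

text \<open>Stands in for the filtration of the process at time \<open>t\<close>; being a finite set
  of coins, it brings every function of the state under the lemmas on finitely many coins.\<close>

definition past :: "nat \<Rightarrow> (nat + 'n::finite \<times> nat) set" where
  "past t = Inl ` {..<t} \<union> Inr ` (UNIV \<times> {..<t})"

lemma finite_past [simp]: "finite (past t)"
  by (simp add: past_def)

lemma past_iff [simp]: "Inl s \<in> past t \<longleftrightarrow> s < t" "Inr (i, s) \<in> past t \<longleftrightarrow> s < t"
  by (auto simp: past_def)

lemma depends_on_gradskip:
  "depends_on (past t) (\<lambda>c. gradskip f \<gamma> p x0 h0 (\<lambda>s. c (Inl s)) (\<lambda>i s. c (Inr (i, s))) t)"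
  unfolding depends_on_def
proof (intro allI impI)
  fix c c' :: "nat + 'a \<times> nat \<Rightarrow> bool"
  assume "\<forall>a\<in>past t. c a = c' a"
  then have *: "c (Inl s) = c' (Inl s)" "c (Inr (i, s)) = c' (Inr (i, s))" if "s < t" for i s
    using that by auto
  have "k \<le> t \<Longrightarrow> gradskip f \<gamma> p x0 h0 (\<lambda>s. c (Inl s)) (\<lambda>i s. c (Inr (i, s))) k
      = gradskip f \<gamma> p x0 h0 (\<lambda>s. c' (Inl s)) (\<lambda>i s. c' (Inr (i, s))) k" for k
    by (induction k) (auto simp: * Suc_le_eq)
  then show "gradskip f \<gamma> p x0 h0 (\<lambda>s. c (Inl s)) (\<lambda>i s. c (Inr (i, s))) t
      = gradskip f \<gamma> p x0 h0 (\<lambda>s. c' (Inl s)) (\<lambda>i s. c' (Inr (i, s))) t" by simp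
qed

locale gradskip_run = coins M "case_sum \<theta> (\<lambda>(i, t). \<eta> i t)"
  for M :: "'w measure" and \<theta> :: "nat \<Rightarrow> 'w \<Rightarrow> bool" and \<eta> :: "'n::finite \<Rightarrow> nat \<Rightarrow> 'w \<Rightarrow> bool" +
  fixes p :: real and q :: "'n \<Rightarrow> real"
  assumes prob_theta: "\<And>t. \<P>(\<omega> in M. \<theta> t \<omega>) = p"
    and prob_eta: "\<And>i t. \<P>(\<omega> in M. \<eta> i t \<omega>) = q i"
begin

lemma theta_measurable [measurable]: "\<theta> t \<in> measurable M (count_space UNIV)"
  using coin_measurable[of "Inl t"] by simp

lemma eta_measurable [measurable]: "\<eta> i t \<in> measurable M (count_space UNIV)"
  using coin_measurable[of "Inr (i, t)"] by simp

abbreviation toss :: "'w \<Rightarrow> nat + 'n \<times> nat \<Rightarrow> bool" where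
  "toss \<omega> \<equiv> \<lambda>a. case_sum \<theta> (\<lambda>(i, t). \<eta> i t) a \<omega>"

lemma expectation_theta_cases:
  fixes F G :: "(nat + 'n \<times> nat \<Rightarrow> bool) \<Rightarrow> real"
  assumes "finite A" "depends_on A F" "depends_on A G" "Inl t \<notin> A"
  shows "expectation (\<lambda>\<omega>. if \<theta> t \<omega> then F (toss \<omega>) else G (toss \<omega>))
    = expectation (\<lambda>\<omega>. p * F (toss \<omega>) + (1 - p) * G (toss \<omega>))"
  using expectation_coin_cases[OF assms] prob_theta by simp

lemma expectation_eta_cases:
  fixes F G :: "(nat + 'n \<times> nat \<Rightarrow> bool) \<Rightarrow> real"
  assumes "finite A" "depends_on A F" "depends_on A G" "Inr (i, t) \<notin> A"
  shows "expectation (\<lambda>\<omega>. if \<eta> i t \<omega> then F (toss \<omega>) else G (toss \<omega>))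
    = expectation (\<lambda>\<omega>. q i * F (toss \<omega>) + (1 - q i) * G (toss \<omega>))"
  using expectation_coin_cases[OF assms] prob_eta by simp

lemma integrable_gradskip:
  fixes g :: "('n \<Rightarrow> 'a::euclidean_space) \<times> ('n \<Rightarrow> 'a) \<Rightarrow> real"
  shows "integrable M (\<lambda>\<omega>. g (gradskip f \<gamma> p' x0 h0 (\<lambda>s. \<theta> s \<omega>) (\<lambda>i s. \<eta> i s \<omega>) t))"
  using integrable_coins[OF finite_past depends_on_comp[OF depends_on_gradskip, where g=g]] by simp

text \<open>The fresh coins are averaged in two stages: first \<open>\<theta> t\<close>, against the
  past and all \<open>\<eta> i t\<close>; then, after the mixture identity has split the sum over
  clients, each \<open>\<eta> i t\<close> against the past alone.\<close>

lemma expectation_lyapunov_Suc: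
  fixes f :: "'n \<Rightarrow> 'a::euclidean_space \<Rightarrow> real"
  assumes opt: "(\<Sum>i\<in>UNIV. grad (f i) xs) = 0" and "p > 0" "\<gamma> > 0"
    and contraction: "\<And>x h. (\<Sum>i\<in>UNIV. (norm (x i - xs - \<gamma> *\<^sub>R (grad (f i) (x i) - grad (f i) xs)))\<^sup>2
       + (1 - p\<^sup>2) * (\<gamma>\<^sup>2 / p\<^sup>2) * (q i * (norm (h i - grad (f i) xs))\<^sup>2
         + (1 - q i) * (norm (grad (f i) (x i) - grad (f i) xs))\<^sup>2))
    \<le> r * lyapunov f \<gamma> p xs (x, h)"
  shows "expectation (\<lambda>\<omega>. lyapunov f \<gamma> p xs (gradskip f \<gamma> p x0 h0 (\<lambda>s. \<theta> s \<omega>) (\<lambda>i s. \<eta> i s \<omega>) (Suc t)))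
    \<le> r * expectation (\<lambda>\<omega>. lyapunov f \<gamma> p xs (gradskip f \<gamma> p x0 h0 (\<lambda>s. \<theta> s \<omega>) (\<lambda>i s. \<eta> i s \<omega>) t))"
proof -
  define S where "S = (\<lambda>c. gradskip f \<gamma> p x0 h0 (\<lambda>s. c (Inl s)) (\<lambda>i s. c (Inr (i, s))) t)"
  have past_S: "depends_on (past t) S"
    unfolding S_def by (rule depends_on_gradskip)
  define S\<omega> where "S\<omega> \<omega> = S (toss \<omega>)" for \<omega>
  have S\<omega>: "S\<omega> \<omega> = gradskip f \<gamma> p x0 h0 (\<lambda>s. \<theta> s \<omega>) (\<lambda>i s. \<eta> i s \<omega>) t" for \<omega>
    by (simp add: S\<omega>_def S_def)
  have S: "depends_on (past t) (\<lambda>c. g (S c))" for g :: "_ \<Rightarrow> real"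
    by (rule depends_on_comp[OF past_S])
  have int: "integrable M (\<lambda>\<omega>. g (S\<omega> \<omega>))" for g :: "_ \<Rightarrow> real"
    unfolding S\<omega> by (rule integrable_gradskip)
  \<comment> \<open>State and current \<open>\<eta>\<close> coins form a single argument, so that
    the dependence on \<open>A\<close> follows by composition.\<close>
  define \<Phi> where "\<Phi> b = (\<lambda>((x, h), e). lyapunov f \<gamma> p xs
      (iterate_next f \<gamma> p b e x h, shift_next f \<gamma> p b e x h))" for b
  define \<Psi> where "\<Psi> b c = \<Phi> b (S c, \<lambda>i. c (Inr (i, t)))" for b c
  define A where "A = past t \<union> range (\<lambda>i::'n. Inr (i, t))"
  have "depends_on A (\<lambda>c. (S c, \<lambda>i. c (Inr (i, t))))"
    unfolding depends_on_def
  proof (intro allI impI)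
    fix c c' :: "nat + 'n \<times> nat \<Rightarrow> bool"
    assume *: "\<forall>a\<in>A. c a = c' a"
    have "S c = S c'"
      using past_S * unfolding depends_on_def A_def by blast
    with * show "(S c, \<lambda>i. c (Inr (i, t))) = (S c', \<lambda>i. c' (Inr (i, t)))" by (auto simp: A_def)
  qed
  from depends_on_comp[OF this] have dep: "depends_on A (\<Psi> b)" for b
    unfolding \<Psi>_def .
  have A: "finite A" "Inl t \<notin> A" by (auto simp: A_def)
  \<comment> \<open>\<open>U\<close>, \<open>V\<close> and \<open>W\<close> are the three
    ingredients of the mixture as functions of the state: the squared errors of the plain gradient
    step, of the old shift, and of the gradient that would replace it.\<close>
  define U :: "'n \<Rightarrow> ('n \<Rightarrow> 'a) \<times> ('n \<Rightarrow> 'a) \<Rightarrow> real" where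
    "U i = (\<lambda>(x, h). (norm (x i - xs - \<gamma> *\<^sub>R (grad (f i) (x i) - grad (f i) xs)))\<^sup>2)" for i
  define V :: "'n \<Rightarrow> ('n \<Rightarrow> 'a) \<times> ('n \<Rightarrow> 'a) \<Rightarrow> real" where
    "V i = (\<lambda>(x, h). (norm (h i - grad (f i) xs))\<^sup>2)" for i
  define W :: "'n \<Rightarrow> ('n \<Rightarrow> 'a) \<times> ('n \<Rightarrow> 'a) \<Rightarrow> real" where
    "W i = (\<lambda>(x, h). (norm (grad (f i) (x i) - grad (f i) xs))\<^sup>2)" for i
  let ?k = "(1 - p\<^sup>2) * (\<gamma>\<^sup>2 / p\<^sup>2)"
  have "expectation (\<lambda>\<omega>. lyapunov f \<gamma> p xs (gradskip f \<gamma> p x0 h0 (\<lambda>s. \<theta> s \<omega>) (\<lambda>i s. \<eta> i s \<omega>) (Suc t)))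
    = expectation (\<lambda>\<omega>. if \<theta> t \<omega> then \<Psi> True (toss \<omega>) else \<Psi> False (toss \<omega>))"
    by (intro Bochner_Integration.integral_cong) (auto simp: \<Psi>_def \<Phi>_def S_def split: prod.split)
  also have "\<dots> = expectation (\<lambda>\<omega>. p * \<Psi> True (toss \<omega>) + (1 - p) * \<Psi> False (toss \<omega>))"
    by (rule expectation_theta_cases[OF A(1) dep dep A(2)])
  also have "\<dots> = expectation (\<lambda>\<omega>. \<Sum>i\<in>UNIV. U i (S\<omega> \<omega>) + ?k * (if \<eta> i t \<omega> then V i (S\<omega> \<omega>) else W i (S\<omega> \<omega>)))"
    using lyapunov_next_mixture[OF assms(1-3)]
    by (intro Bochner_Integration.integral_cong)
       (auto simp: \<Psi>_def \<Phi>_def S\<omega>_def U_def V_def W_def split: prod.split intro!: sum.cong)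
  also have "\<dots> = (\<Sum>i\<in>UNIV. expectation (\<lambda>\<omega>. U i (S\<omega> \<omega>)) +
      ?k * expectation (\<lambda>\<omega>. if \<eta> i t \<omega> then V i (S\<omega> \<omega>) else W i (S\<omega> \<omega>)))"
  proof -
    have dep: "depends_on (past (Suc t)) (\<lambda>c. if c (Inr (i, t)) then V i (S c) else W i (S c))" for i
      using S by (intro depends_on_If depends_on_mono[OF S]) (auto simp: past_def)
    have "integrable M (\<lambda>\<omega>. if \<eta> i t \<omega> then V i (S\<omega> \<omega>) else W i (S\<omega> \<omega>))" for i
      unfolding S\<omega>_def using integrable_coins[OF finite_past dep[of i]] by simp
    then show ?thesis by (simp add: int)
  qed
  also have "\<dots> = (\<Sum>i\<in>UNIV. expectation (\<lambda>\<omega>. U i (S\<omega> \<omega>)) +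
      ?k * expectation (\<lambda>\<omega>. q i * V i (S\<omega> \<omega>) + (1 - q i) * W i (S\<omega> \<omega>)))"
    unfolding S\<omega>_def by (simp add: expectation_eta_cases[OF finite_past S S])
  also have "\<dots> = expectation (\<lambda>\<omega>. \<Sum>i\<in>UNIV. U i (S\<omega> \<omega>) + ?k * (q i * V i (S\<omega> \<omega>) + (1 - q i) * W i (S\<omega> \<omega>)))"
    by (simp add: int)
  also have "\<dots> \<le> expectation (\<lambda>\<omega>. r * lyapunov f \<gamma> p xs (S\<omega> \<omega>))"
  proof (rule integral_mono)
    show "(\<Sum>i\<in>UNIV. U i (S\<omega> \<omega>) + ?k * (q i * V i (S\<omega> \<omega>) + (1 - q i) * W i (S\<omega> \<omega>)))
        \<le> r * lyapunov f \<gamma> p xs (S\<omega> \<omega>)" for \<omega>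
      using contraction by (cases "S\<omega> \<omega>") (simp add: U_def V_def W_def)
  qed (simp_all add: int)
  finally show ?thesis by (simp add: S\<omega>)
qed

lemma expectation_lyapunov_le:
  fixes f :: "'n \<Rightarrow> 'a::euclidean_space \<Rightarrow> real"
  assumes opt: "(\<Sum>i\<in>UNIV. grad (f i) xs) = 0" and "p > 0" "\<gamma> > 0" "0 \<le> r"
    and contraction: "\<And>x h. (\<Sum>i\<in>UNIV. (norm (x i - xs - \<gamma> *\<^sub>R (grad (f i) (x i) - grad (f i) xs)))\<^sup>2
       + (1 - p\<^sup>2) * (\<gamma>\<^sup>2 / p\<^sup>2) * (q i * (norm (h i - grad (f i) xs))\<^sup>2
         + (1 - q i) * (norm (grad (f i) (x i) - grad (f i) xs))\<^sup>2))
    \<le> r * lyapunov f \<gamma> p xs (x, h)"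
  shows "expectation (\<lambda>\<omega>. lyapunov f \<gamma> p xs (gradskip f \<gamma> p x0 h0 (\<lambda>s. \<theta> s \<omega>) (\<lambda>i s. \<eta> i s \<omega>) t))
    \<le> r ^ t * lyapunov f \<gamma> p xs (x0, h0)"
proof (induction t)
  case 0
  then show ?case by (simp add: prob_space)
next
  case (Suc t)
  from mult_left_mono[OF Suc \<open>0 \<le> r\<close>] expectation_lyapunov_Suc[OF assms(1-3,5), of x0 h0 t]
  show ?case by (simp add: mult.assoc del: gradskip.simps)
qed

lemma expectation_communications:
  "expectation (\<lambda>\<omega>. real (card {t. t < T \<and> \<theta> t \<omega>})) = real T * p"
proof -
  have "real (card {t. t < T \<and> \<theta> t \<omega>}) = (\<Sum>t<T. indicator {\<omega>\<in>space M. \<theta> t \<omega>} \<omega>)"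
    if "\<omega> \<in> space M" for \<omega>
    using that by (simp add: indicator_def sum.If_cases Int_def)
  then have "expectation (\<lambda>\<omega>. real (card {t. t < T \<and> \<theta> t \<omega>}))
      = expectation (\<lambda>\<omega>. \<Sum>t<T. indicator {\<omega>\<in>space M. \<theta> t \<omega>} \<omega>)"
    by (intro Bochner_Integration.integral_cong) auto
  also have "\<dots> = (\<Sum>t<T. p)"
    by (subst Bochner_Integration.integral_sum)
       (auto simp: prob_theta integrable_real_indicator emeasure_eq_measure)
  finally show ?thesis by simp
qed

end

section \<open>Local gradient computations\<close>

context gradskip_run begin

lemma prob_eq_expectation_of_bool:
  "\<P>(\<omega> in M. P \<omega>) = expectation (\<lambda>\<omega>. of_bool (P \<omega>))"
proof -
  have "expectation (\<lambda>\<omega>. of_bool (P \<omega>)) = expectation (indicat_real {\<omega> \<in> space M. P \<omega>})"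
    by (intro Bochner_Integration.integral_cong) auto
  then show ?thesis by (simp add: Int_def conj_ac)
qed

text \<open>The event that the round starts at \<open>s\<close> reads only coins before
  \<open>s\<close>. Each further iteration without communication and with \<open>\<eta> = 1\<close>
  involves two fresh independent coins and contributes the factor
  \<open>q i * (1 - p)\<close>.\<close>

lemma prob_round_cylinder:
  "\<P>(\<omega> in M. round_start (\<lambda>t. \<theta> t \<omega>) r = enat s \<and> (\<forall>t\<in>{s..<s + k}. \<not> \<theta> t \<omega> \<and> \<eta> i t \<omega>))
     = (q i * (1 - p)) ^ k * \<P>(\<omega> in M. round_start (\<lambda>t. \<theta> t \<omega>) r = enat s)"
proof (induction k)
  case (Suc k)
  define F :: "(nat + 'n \<times> nat \<Rightarrow> bool) \<Rightarrow> real" where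
    "F c = of_bool (round_start (\<lambda>t. c (Inl t)) r = enat s \<and>
        (\<forall>t\<in>{s..<s + k}. \<not> c (Inl t) \<and> c (Inr (i, t))))" for c
  have F: "depends_on (past (s + k)) F"
    unfolding depends_on_def
  proof (intro allI impI)
    fix c c' :: "nat + 'n \<times> nat \<Rightarrow> bool"
    assume "\<forall>a\<in>past (s + k). c a = c' a"
    then have *: "c (Inl t) = c' (Inl t)" "c (Inr (i, t)) = c' (Inr (i, t))" if "t < s + k" for t
      using that by auto
    then have "round_start (\<lambda>t. c (Inl t)) r = enat s \<longleftrightarrow> round_start (\<lambda>t. c' (Inl t)) r = enat s"
      by (intro round_start_cong) auto
    with * show "F c = F c'" by (simp add: F_def)
  qed
  \<comment> \<open>The coin \<open>\<theta> (s + k)\<close> is averaged first, while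
    \<open>\<eta> i (s + k)\<close> still counts as given; the latter is then averaged against the
    past.\<close>
  define A where "A = insert (Inr (i, s + k)) (past (s + k) :: (nat + 'n \<times> nat) set)"
  have A: "finite A" "Inl (s + k) \<notin> A" "past (s + k) \<subseteq> A" "Inr (i, s + k) \<in> A"
    by (auto simp: A_def)
  have zero: "depends_on B (\<lambda>_. 0 :: real)" for B :: "(nat + 'n \<times> nat) set"
    by (simp add: depends_on_def)
  have G: "depends_on A (\<lambda>c. if c (Inr (i, s + k)) then F c else 0)"
    by (intro depends_on_If zero depends_on_mono[OF F] A)
  have *: "toss \<omega> (Inr (i, s + k)) = \<eta> i (s + k) \<omega>" for \<omega> by simp
  have "\<P>(\<omega> in M. round_start (\<lambda>t. \<theta> t \<omega>) r = enat s \<and> (\<forall>t\<in>{s..<s + Suc k}. \<not> \<theta> t \<omega> \<and> \<eta> i t \<omega>))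
    = expectation (\<lambda>\<omega>. if \<theta> (s + k) \<omega> then 0 else if \<eta> i (s + k) \<omega> then F (toss \<omega>) else 0)"
    unfolding prob_eq_expectation_of_bool F_def
    by (intro Bochner_Integration.integral_cong) (auto simp: atLeastLessThanSuc)
  also have "\<dots> = (1 - p) * expectation (\<lambda>\<omega>. if \<eta> i (s + k) \<omega> then F (toss \<omega>) else 0)"
    using expectation_theta_cases[OF A(1) zero G A(2)] unfolding * by simp
  also have "expectation (\<lambda>\<omega>. if \<eta> i (s + k) \<omega> then F (toss \<omega>) else 0) = q i * expectation (\<lambda>\<omega>. F (toss \<omega>))"
    using expectation_eta_cases[OF finite_past F zero, of i "s + k"] by simp
  also have "expectation (\<lambda>\<omega>. F (toss \<omega>)) =
     \<P>(\<omega> in M. round_start (\<lambda>t. \<theta> t \<omega>) r = enat s \<and> (\<forall>t\<in>{s..<s + k}. \<not> \<theta> t \<omega> \<and> \<eta> i t \<omega>))"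
    unfolding prob_eq_expectation_of_bool F_def by simp
  finally show ?case using Suc.IH by (simp add: mult_ac)
qed simp

lemma prob_no_communication: "\<P>(\<omega> in M. \<forall>t\<in>{s..<s + k}. \<not> \<theta> t \<omega>) = (1 - p) ^ k"
proof (induction k)
  case (Suc k)
  define F :: "(nat + 'n \<times> nat \<Rightarrow> bool) \<Rightarrow> real" where
    "F c = of_bool (\<forall>t\<in>{s..<s + k}. \<not> c (Inl t))" for c
  have "depends_on (past (s + k)) F"
    by (auto simp: depends_on_def F_def)
  then have "expectation (\<lambda>\<omega>. if \<theta> (s + k) \<omega> then 0 else F (toss \<omega>)) = (1 - p) * expectation (\<lambda>\<omega>. F (toss \<omega>))"
    using expectation_theta_cases[OF finite_past, of "s + k" "\<lambda>_. 0" F "s + k"] by (simp add: depends_on_def)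
  moreover have "\<P>(\<omega> in M. \<forall>t\<in>{s..<s + Suc k}. \<not> \<theta> t \<omega>) = expectation (\<lambda>\<omega>. if \<theta> (s + k) \<omega> then 0 else F (toss \<omega>))"
    unfolding prob_eq_expectation_of_bool F_def
    by (intro Bochner_Integration.integral_cong) (auto simp: atLeastLessThanSuc)
  moreover have "expectation (\<lambda>\<omega>. F (toss \<omega>)) = \<P>(\<omega> in M. \<forall>t\<in>{s..<s + k}. \<not> \<theta> t \<omega>)"
    unfolding prob_eq_expectation_of_bool F_def by simp
  ultimately show ?case using Suc.IH by simp
qed (simp add: prob_space)

text \<open>Silence from time \<open>s\<close> on entails \<open>k\<close> silent tosses for every
  \<open>k\<close>, so its probability is at most \<open>(1 - p) ^ k\<close>, which tends to 0.
  Countably many \<open>s\<close> leave a null set.\<close>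

lemma AE_round_start_finite:
  assumes "0 < p" "p \<le> 1"
  shows "AE \<omega> in M. round_start (\<lambda>t. \<theta> t \<omega>) r \<noteq> \<infinity>"
proof -
  have "AE \<omega> in M. \<exists>t\<ge>s. \<theta> t \<omega>" for s
  proof -
    let ?N = "{\<omega> \<in> space M. \<forall>t\<ge>s. \<not> \<theta> t \<omega>}"
    have "(\<lambda>k. (1 - p) ^ k) \<longlonglongrightarrow> 0" using assms by (intro LIMSEQ_realpow_zero) auto
    moreover have "prob ?N \<le> (1 - p) ^ k" for k
      unfolding prob_no_communication[of s k, symmetric] by (intro finite_measure_mono) auto
    ultimately have "prob ?N \<le> 0" by (intro LIMSEQ_le_const) auto
    moreover have "?N \<in> events" by measurable
    ultimately have "?N \<in> null_sets M" by (simp add: null_sets_def emeasure_eq_measure measure_le_0_iff)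
    then show ?thesis by (rule AE_I') auto
  qed
  then have "AE \<omega> in M. \<forall>s. \<exists>t\<ge>s. \<theta> t \<omega>" by (simp add: AE_all_countable)
  then show ?thesis by eventually_elim (simp add: round_start_finite)
qed

lemma round_start_event [measurable]:
  "Measurable.pred M (\<lambda>\<omega>. round_start (\<lambda>t. \<theta> t \<omega>) r = enat s)"
proof -
  have "depends_on (past s) (\<lambda>c :: nat + 'n \<times> nat \<Rightarrow> bool. round_start (\<lambda>t. c (Inl t)) r = enat s)"
    unfolding depends_on_def by (auto intro!: round_start_cong)
  then show ?thesis
    using measurable_coins[OF finite_past, of s _ "count_space UNIV"] by fastforce
qed

text \<open>The implication is vacuous for a round that never starts, in agreement with the value
  \<open>\<infinity>\<close> of \<open>local_gradients\<close> there. The quantifiers are countable,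
  which gives measurability.\<close>

lemma less_local_gradients_iff:
  "enat k < local_gradients (\<lambda>t. \<theta> t \<omega>) (\<lambda>t. \<eta> i t \<omega>) r \<longleftrightarrow>
    (\<forall>s. round_start (\<lambda>t. \<theta> t \<omega>) r = enat s \<longrightarrow> (\<forall>t\<in>{s..<s + k}. \<not> \<theta> t \<omega> \<and> \<eta> i t \<omega>))"
proof (cases "round_start (\<lambda>t. \<theta> t \<omega>) r")
  case (enat s)
  then show ?thesis by (simp add: less_local_gradients)
next
  case infinity
  then show ?thesis by (simp add: local_gradients_def)
qed

lemma local_gradients_measurable [measurable]:
  "(\<lambda>\<omega>. local_gradients (\<lambda>t. \<theta> t \<omega>) (\<lambda>t. \<eta> i t \<omega>) r) \<in> measurable M (count_space UNIV)"
  by (rule measurable_enatI) (unfold less_local_gradients_iff, measurable)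

text \<open>Total probability over the start \<open>s\<close> of the round: the cylinder factor is
  the same for each \<open>s\<close>, and the starting probabilities sum to 1 because the start is
  almost surely finite.\<close>

lemma prob_less_local_gradients:
  assumes "0 < p" "p \<le> 1"
  shows "\<P>(\<omega> in M. enat k < local_gradients (\<lambda>t. \<theta> t \<omega>) (\<lambda>t. \<eta> i t \<omega>) r) = (q i * (1 - p)) ^ k"
proof -
  let ?R = "\<lambda>s \<omega>. round_start (\<lambda>t. \<theta> t \<omega>) r = enat s"
  let ?C = "\<lambda>s \<omega>. \<forall>t\<in>{s..<s + k}. \<not> \<theta> t \<omega> \<and> \<eta> i t \<omega>"
  have R: "(\<lambda>s. \<P>(\<omega> in M. ?R s \<omega>)) sums prob (\<Union>s. {\<omega> \<in> space M. ?R s \<omega>})"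
    by (intro finite_measure_UNION) (auto simp: disjoint_family_on_def)
  have "prob (\<Union>s. {\<omega> \<in> space M. ?R s \<omega>}) = 1"
    using AE_round_start_finite[OF assms, of r] by (subst prob_eq_1) auto
  with R have lim: "(\<lambda>s. (q i * (1 - p)) ^ k * \<P>(\<omega> in M. ?R s \<omega>)) sums ((q i * (1 - p)) ^ k)"
    using sums_mult[OF R, of "(q i * (1 - p)) ^ k"] by simp
  have "(\<lambda>s. \<P>(\<omega> in M. ?R s \<omega> \<and> ?C s \<omega>)) sums prob (\<Union>s. {\<omega> \<in> space M. ?R s \<omega> \<and> ?C s \<omega>})"
    by (intro finite_measure_UNION) (auto simp: disjoint_family_on_def)
  from sums_unique2[OF this[unfolded prob_round_cylinder] lim]
  have "prob (\<Union>s. {\<omega> \<in> space M. ?R s \<omega> \<and> ?C s \<omega>}) = (q i * (1 - p)) ^ k" .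
  moreover have "\<P>(\<omega> in M. enat k < local_gradients (\<lambda>t. \<theta> t \<omega>) (\<lambda>t. \<eta> i t \<omega>) r)
    = prob (\<Union>s. {\<omega> \<in> space M. ?R s \<omega> \<and> ?C s \<omega>})"
  proof (rule finite_measure_eq_AE)
    show "AE \<omega> in M. \<omega> \<in> {\<omega> \<in> space M. enat k < local_gradients (\<lambda>t. \<theta> t \<omega>) (\<lambda>t. \<eta> i t \<omega>) r} \<longleftrightarrow>
        \<omega> \<in> (\<Union>s. {\<omega> \<in> space M. ?R s \<omega> \<and> ?C s \<omega>})"
      using AE_round_start_finite[OF assms, of r]
    proof eventually_elim
      case (elim \<omega>)
      then obtain s where "round_start (\<lambda>t. \<theta> t \<omega>) r = enat s" by auto
      then show ?case by (simp add: less_local_gradients_iff)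
    qed
  qed measurable
  ultimately show ?thesis by simp
qed

text \<open>The expectation of an extended natural number is the sum of its tail probabilities, here
  a geometric series. Positivity of \<open>p\<close> keeps the ratio below 1 even if
  \<open>q i = 1\<close>.\<close>

lemma expectation_local_gradients:
  assumes "0 < p" "p \<le> 1" "0 \<le> q i" "q i \<le> 1"
  shows "(\<integral>\<^sup>+\<omega>. ennreal_of_enat (local_gradients (\<lambda>t. \<theta> t \<omega>) (\<lambda>t. \<eta> i t \<omega>) r) \<partial>M)
     = ennreal (1 / (1 - q i * (1 - p)))"
proof -
  have a: "0 \<le> q i * (1 - p)" "q i * (1 - p) < 1"
    using assms mult_right_mono[of "q i" 1 "1 - p"] by auto
  have "(\<integral>\<^sup>+\<omega>. ennreal_of_enat (local_gradients (\<lambda>t. \<theta> t \<omega>) (\<lambda>t. \<eta> i t \<omega>) r) \<partial>M)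
     = (\<Sum>k. emeasure M {\<omega> \<in> space M. enat k < local_gradients (\<lambda>t. \<theta> t \<omega>) (\<lambda>t. \<eta> i t \<omega>) r})"
    by (rule nn_integral_enat_function) measurable
  also have "\<dots> = (\<Sum>k. ennreal ((q i * (1 - p)) ^ k))"
    by (simp add: emeasure_eq_measure prob_less_local_gradients assms)
  also have "\<dots> = ennreal (1 / (1 - q i * (1 - p)))"
    using a by (intro suminf_ennreal_eq geometric_sums) auto
  finally show ?thesis .
qed

end

section \<open>Complexity\<close>

text \<open>The constant 3 makes the O-notation explicit. \<open>T\<close> is chosen before
  \<open>x0\<close> and \<open>h0\<close>, so one iteration count serves all initial data.
  Integrability is asserted too, since the integral of a non-integrable function defaults to
  0.\<close>

theorem theorem3p6:
  fixes f :: "'n::finite \<Rightarrow> 'a::euclidean_space \<Rightarrow> real"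
    and \<mu> :: real and L \<kappa> q :: "'n \<Rightarrow> real"
    and Lmax \<kappa>max p \<gamma> :: real
    and xs :: 'a
    and M :: "'w measure"
    and \<theta> :: "nat \<Rightarrow> 'w \<Rightarrow> bool" and \<eta> :: "'n \<Rightarrow> nat \<Rightarrow> 'w \<Rightarrow> bool"
  assumes diff: "\<And>i x. f i differentiable (at x)"
    and mu_pos: "\<mu> > 0" and L_pos: "\<And>i. L i > 0"
    and lower: "\<And>i x y. \<mu> / 2 * (norm (x - y))\<^sup>2 \<le> bregman (f i) x y"
    and upper: "\<And>i x y. bregman (f i) x y \<le> L i / 2 * (norm (x - y))\<^sup>2"
    and minimizer: "\<And>y. mean (\<lambda>i. f i xs) \<le> mean (\<lambda>i. f i y)"
    and kappa: "\<And>i. \<kappa> i = L i / \<mu>"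
    and kappa_max: "\<kappa>max = Max (range \<kappa>)"
    and L_max: "Lmax = Max (range L)"
    \<comment> \<open>if \<open>\<kappa>max = 1\<close>, the formula for \<open>q i\<close> reads 0/0 and any probability is allowed\<close>
    and q: "\<And>i. \<kappa>max \<noteq> 1 \<Longrightarrow> q i = (1 - 1 / \<kappa> i) / (1 - 1 / \<kappa>max)"
    and q_degenerate: "\<And>i. \<kappa>max = 1 \<Longrightarrow> 0 \<le> q i \<and> q i \<le> 1"
    and p: "p = 1 / sqrt \<kappa>max"
    and gamma: "\<gamma> = 1 / Lmax"
    and coins: "gradskip_coins M p q \<theta> \<eta>"
  shows "(\<forall>i. 0 \<le> q i \<and> q i \<le> 1) \<and> 0 < p \<and> p \<le> 1
    \<and> admissible_stepsize L p q \<gamma> \<and> (\<forall>\<gamma>'. admissible_stepsize L p q \<gamma>' \<longrightarrow> \<gamma>' \<le> \<gamma>)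
    \<and> (\<forall>\<epsilon>::real. 0 < \<epsilon> \<and> \<epsilon> \<le> 1 / 2 \<longrightarrow>
         (\<exists>T::nat.
            real T \<le> 3 * (\<kappa>max * ln (1 / \<epsilon>))
          \<and> (\<forall>x0 h0. \<forall>t\<ge>T.
               integrable M (\<lambda>\<omega>. lyapunov f \<gamma> p xs
                 (gradskip f \<gamma> p x0 h0 (\<lambda>s. \<theta> s \<omega>) (\<lambda>i s. \<eta> i s \<omega>) t))
             \<and> (\<integral>\<omega>. lyapunov f \<gamma> p xs
                 (gradskip f \<gamma> p x0 h0 (\<lambda>s. \<theta> s \<omega>) (\<lambda>i s. \<eta> i s \<omega>) t) \<partial>M)
               \<le> \<epsilon> * lyapunov f \<gamma> p xs (x0, h0))
          \<and> (\<integral>\<omega>. real (card {t. t < T \<and> \<theta> t \<omega>}) \<partial>M) \<le> 3 * (sqrt \<kappa>max * ln (1 / \<epsilon>))))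
    \<and> (\<forall>i.
         (\<forall>r. (\<integral>\<^sup>+\<omega>. ennreal_of_enat (local_gradients (\<lambda>t. \<theta> t \<omega>) (\<lambda>t. \<eta> i t \<omega>) r) \<partial>M)
              = ennreal (1 / (1 - q i * (1 - p))))
       \<and> 1 / (1 - q i * (1 - p)) = \<kappa> i * (1 + sqrt \<kappa>max) / (\<kappa> i + sqrt \<kappa>max)
       \<and> \<kappa> i * (1 + sqrt \<kappa>max) / (\<kappa> i + sqrt \<kappa>max) \<le> min (\<kappa> i) (sqrt \<kappa>max))"
proof -

  \<comment> \<open>Condition numbers, probabilities and stepsize\<close>
  have L_le: "L i \<le> Lmax" for i
    unfolding L_max by (intro Max_ge) auto
  have "Lmax \<in> range L" unfolding L_max by (intro Max_in) auto
  then obtain m where m: "Lmax = L m" by auto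
  have \<kappa>max: "\<kappa>max = Lmax / \<mu>"
  proof -
    have "\<kappa>max \<in> range \<kappa>" unfolding kappa_max by (intro Max_in) auto
    moreover have "\<kappa> m \<le> \<kappa>max" unfolding kappa_max by (intro Max_ge) auto
    ultimately show ?thesis
      using L_le mu_pos m by (auto simp: kappa intro!: antisym divide_right_mono)
  qed
  \<comment> \<open>A unit vector, available in every Euclidean space, separates the two quadratic
    bounds and forces \<open>\<mu> \<le> L i\<close>.\<close>
  have \<kappa>_ge1: "1 \<le> \<kappa> i" for i
  proof -
    obtain b :: 'a where "b \<in> Basis" using nonempty_Basis by blast
    then have "norm b = 1" by simp
    then have "\<mu> / 2 \<le> L i / 2"
      using order_trans[OF lower[of b 0 i] upper[of i b 0]] by simp
    then show ?thesis using mu_pos by (simp add: kappa)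
  qed
  have \<kappa>_le: "\<kappa> i \<le> \<kappa>max" for i
    using L_le mu_pos by (simp add: kappa \<kappa>max divide_right_mono)
  have \<kappa>max_ge1: "1 \<le> \<kappa>max" using \<kappa>_ge1 \<kappa>_le order_trans by blast
  have Lmax_pos: "0 < Lmax" using L_pos m by simp
  have p_pos: "0 < p" and p_le: "p \<le> 1" and p2: "p\<^sup>2 = 1 / \<kappa>max"
    using \<kappa>max_ge1 by (simp_all add: p power_divide)
  have \<gamma>_pos: "0 < \<gamma>" and \<gamma>\<mu>: "\<gamma> * \<mu> = 1 / \<kappa>max"
    using Lmax_pos mu_pos by (simp_all add: gamma \<kappa>max)
  have q_bounds: "0 \<le> q i \<and> q i \<le> 1" for i
  proof (cases "\<kappa>max = 1")
    case False
    then have "0 < 1 - 1 / \<kappa>max" using \<kappa>max_ge1 by simp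
    moreover have "1 / \<kappa>max \<le> 1 / \<kappa> i" "1 / \<kappa> i \<le> 1"
      using \<kappa>_ge1[of i] \<kappa>_le[of i] by (simp_all add: frac_le)
    ultimately show ?thesis using q[OF False, of i] by simp
  qed (use q_degenerate in blast)
  \<comment> \<open>The choice of \<open>p\<close> makes \<open>1 - p\<^sup>2\<close> the
    denominator of \<open>q i\<close>. If \<open>\<kappa>max = 1\<close>, both sides vanish for any
    \<open>q i\<close>.\<close>
  have q_p2: "q i * (1 - p\<^sup>2) = 1 - 1 / \<kappa> i" for i
  proof (cases "\<kappa>max = 1")
    case True
    then have "\<kappa> i = 1" using \<kappa>_ge1[of i] \<kappa>_le[of i] by simp
    with True show ?thesis by (simp add: p2)
  next
    case False
    then have "1 - 1 / \<kappa>max \<noteq> 0" using \<kappa>max_ge1 by simp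
    then show ?thesis unfolding p2 q[OF False] by simp
  qed
  \<comment> \<open>The probabilities \<open>q i\<close> equalize the stepsize bounds of all
    clients, so the minimum equals \<open>\<gamma>\<close> itself.\<close>
  have admissible_bound: "1 / L i * (p\<^sup>2 / (1 - q i * (1 - p\<^sup>2))) = \<gamma>" for i
    unfolding q_p2 unfolding p2 using L_pos[of i] mu_pos Lmax_pos by (simp add: kappa \<kappa>max gamma)
  have opt: "(\<Sum>i\<in>UNIV. grad (f i) xs) = 0"
    by (rule sum_grad_minimizer[OF upper L_pos minimizer])
  interpret gradskip_run M \<theta> \<eta> p q
  proof -
    have "prob_space M" using coins by (simp add: gradskip_coins_def)
    then interpret prob_space M .
    show "gradskip_run M \<theta> \<eta> p q"
      by unfold_locales (use coins in \<open>auto simp: gradskip_coins_def\<close>)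
  qed

  \<comment> \<open>Geometric decay in expectation\<close>
  let ?\<Psi> = "lyapunov f \<gamma> p xs"
  define r where "r = 1 - 1 / \<kappa>max"
  have r: "0 \<le> r" using \<kappa>max_ge1 by (simp add: r_def)
  have decay: "(\<integral>\<omega>. ?\<Psi> (gradskip f \<gamma> p x0 h0 (\<lambda>s. \<theta> s \<omega>) (\<lambda>i s. \<eta> i s \<omega>) t) \<partial>M) \<le> r ^ t * ?\<Psi> (x0, h0)"
    for x0 h0 t
  proof (rule expectation_lyapunov_le[OF opt p_pos \<gamma>_pos r])
    \<comment> \<open>The iterate part contracts at rate
      \<open>\<gamma> * \<mu> = 1 / \<kappa>max\<close>, the shift part of client \<open>i\<close>
      at rate \<open>1 / \<kappa> i\<close>, which is no slower.\<close>
    have rate: "1 / \<kappa>max \<le> \<gamma> * \<mu>" "q i * (1 - p\<^sup>2) \<le> 1 - 1 / \<kappa>max" for i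
      using \<kappa>_ge1[of i] \<kappa>_le[of i] by (simp_all add: \<gamma>\<mu> q_p2 frac_le)
    have step: "\<gamma> * L i * (1 - q i * (1 - p\<^sup>2)) \<le> p\<^sup>2" for i
      unfolding q_p2 unfolding p2 using L_pos[of i] mu_pos Lmax_pos by (simp add: kappa \<kappa>max gamma)
    show "(\<Sum>i\<in>UNIV. (norm (x i - xs - \<gamma> *\<^sub>R (grad (f i) (x i) - grad (f i) xs)))\<^sup>2
       + (1 - p\<^sup>2) * (\<gamma>\<^sup>2 / p\<^sup>2) * (q i * (norm (h i - grad (f i) xs))\<^sup>2
         + (1 - q i) * (norm (grad (f i) (x i) - grad (f i) xs))\<^sup>2))
      \<le> r * ?\<Psi> (x, h)" for x h
      unfolding r_def
      by (rule lyapunov_contraction[OF lower upper L_pos less_imp_le[OF mu_pos] \<gamma>_pos p_pos step rate])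
  qed

  \<comment> \<open>Iteration and communication complexity\<close>
  have complexity: "\<exists>T::nat. real T \<le> 3 * (\<kappa>max * ln (1 / \<epsilon>))
      \<and> (\<forall>x0 h0. \<forall>t\<ge>T. integrable M (\<lambda>\<omega>. ?\<Psi> (gradskip f \<gamma> p x0 h0 (\<lambda>s. \<theta> s \<omega>) (\<lambda>i s. \<eta> i s \<omega>) t))
           \<and> (\<integral>\<omega>. ?\<Psi> (gradskip f \<gamma> p x0 h0 (\<lambda>s. \<theta> s \<omega>) (\<lambda>i s. \<eta> i s \<omega>) t) \<partial>M) \<le> \<epsilon> * ?\<Psi> (x0, h0))
      \<and> (\<integral>\<omega>. real (card {t. t < T \<and> \<theta> t \<omega>}) \<partial>M) \<le> 3 * (sqrt \<kappa>max * ln (1 / \<epsilon>))"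
    if \<epsilon>: "0 < \<epsilon>" "\<epsilon> \<le> 1 / 2" for \<epsilon> :: real
  proof -
    \<comment> \<open>Rounding up adds less than 1. From
      \<open>exp (1 / 2) \<le> 2 \<le> 1 / \<epsilon>\<close> the rounded quantity is at least
      \<open>1 / 2\<close>, so this 1 is at most twice it; hence the factor 3.\<close>
    define T where "T = nat \<lceil>\<kappa>max * ln (1 / \<epsilon>)\<rceil>"
    have "exp (1 / 2 :: real) \<le> 2"
      by (rule exp_half_le2)
    also have "2 \<le> 1 / \<epsilon>" using \<epsilon> by (simp add: field_simps)
    finally have "1 / 2 \<le> ln (1 / \<epsilon>)" using ln_ge_iff[of "1 / \<epsilon>" "1 / 2"] \<epsilon> by simp
    moreover from this have "1 * (1 / 2) \<le> \<kappa>max * ln (1 / \<epsilon>)"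
      using \<kappa>max_ge1 by (intro mult_mono) auto
    ultimately have T_ge: "\<kappa>max * ln (1 / \<epsilon>) \<le> real T" and T_le: "real T \<le> 3 * (\<kappa>max * ln (1 / \<epsilon>))"
      unfolding T_def by linarith+
    have "r ^ t \<le> \<epsilon>" if "t \<ge> T" for t
    proof -
      have "r ^ t \<le> exp (- (1 / \<kappa>max)) ^ t"
        using exp_ge_add_one_self[of "- (1 / \<kappa>max)"] r by (intro power_mono) (simp_all add: r_def)
      also have "\<dots> = exp (- (real t / \<kappa>max))"
        by (simp add: exp_of_nat_mult[symmetric])
      also have "\<dots> \<le> exp (- ln (1 / \<epsilon>))"
      proof -
        have "\<kappa>max * ln (1 / \<epsilon>) \<le> real t" using T_ge that by linarith
        then show ?thesis using \<kappa>max_ge1 by (simp add: field_simps)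
      qed
      also have "\<dots> = \<epsilon>" using \<epsilon> by (simp add: exp_minus)
      finally show ?thesis .
    qed
    moreover have "0 \<le> ?\<Psi> z" for z
      by (cases z) (auto simp: lyapunov_eq_sum intro!: sum_nonneg)
    ultimately have "(\<integral>\<omega>. ?\<Psi> (gradskip f \<gamma> p x0 h0 (\<lambda>s. \<theta> s \<omega>) (\<lambda>i s. \<eta> i s \<omega>) t) \<partial>M) \<le> \<epsilon> * ?\<Psi> (x0, h0)"
      if "t \<ge> T" for x0 h0 t
      using that by (intro order_trans[OF decay] mult_right_mono) auto
    moreover have "(\<integral>\<omega>. real (card {t. t < T \<and> \<theta> t \<omega>}) \<partial>M) \<le> 3 * (sqrt \<kappa>max * ln (1 / \<epsilon>))"
    proof -
      have "(\<integral>\<omega>. real (card {t. t < T \<and> \<theta> t \<omega>}) \<partial>M) = real T * p"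
        by (rule expectation_communications)
      also have "\<dots> \<le> 3 * (\<kappa>max * ln (1 / \<epsilon>)) * p"
        using T_le p_pos by (intro mult_right_mono) auto
      also have "\<dots> = 3 * (\<kappa>max / sqrt \<kappa>max * ln (1 / \<epsilon>))" by (simp add: p)
      also have "\<kappa>max / sqrt \<kappa>max = sqrt \<kappa>max"
        using \<kappa>max_ge1 by (intro real_div_sqrt) auto
      finally show ?thesis .
    qed
    ultimately show ?thesis
      using T_le integrable_gradskip[where g="?\<Psi>"] by blast
  qed

  \<comment> \<open>Gradient computations per round\<close>
  have closed_form: "1 / (1 - q i * (1 - p)) = \<kappa> i * (1 + sqrt \<kappa>max) / (\<kappa> i + sqrt \<kappa>max)" for i
  proof -
    define s where "s = sqrt \<kappa>max"
    have s: "1 \<le> s" "p = 1 / s" using \<kappa>max_ge1 by (simp_all add: s_def p)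
    have k: "1 \<le> \<kappa> i" by (rule \<kappa>_ge1)
    \<comment> \<open>Multiplying by \<open>1 + p\<close> turns \<open>1 - p\<close> into
      \<open>1 - p\<^sup>2\<close>, for which \<open>q_p2\<close> is available.\<close>
    have "q i * (1 - p) * (1 + p) = 1 - 1 / \<kappa> i"
      unfolding q_p2[symmetric] by (simp add: algebra_simps power2_eq_square)
    then have "(1 - q i * (1 - p)) * (1 + p) = p + 1 / \<kappa> i" by (simp add: algebra_simps)
    then have "1 - q i * (1 - p) = (p + 1 / \<kappa> i) / (1 + p)"
      using p_pos by (simp add: eq_divide_eq)
    also have "\<dots> = (\<kappa> i + s) / (\<kappa> i * (1 + s))"
      unfolding s(2) using s(1) k by (simp add: field_simps add_nonneg_eq_0_iff)
    finally show ?thesis by (simp add: s_def)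
  qed
  have bound: "\<kappa> i * (1 + sqrt \<kappa>max) / (\<kappa> i + sqrt \<kappa>max) \<le> min (\<kappa> i) (sqrt \<kappa>max)" for i
  proof -
    define s where "s = sqrt \<kappa>max"
    have s: "1 \<le> s" "\<kappa> i \<le> s * s" using \<kappa>max_ge1 \<kappa>_le[of i] by (simp_all add: s_def)
    have k: "1 \<le> \<kappa> i" by (rule \<kappa>_ge1)
    \<comment> \<open>The bound by \<open>\<kappa> i\<close> comes from
      \<open>1 \<le> \<kappa> i\<close>, the bound by \<open>s\<close> from
      \<open>\<kappa> i \<le> s * s\<close>.\<close>
    have "\<kappa> i * (1 + s) \<le> \<kappa> i * (\<kappa> i + s)" using k by (intro mult_left_mono) auto
    moreover have "\<kappa> i * (1 + s) \<le> s * (\<kappa> i + s)" using s by (simp add: algebra_simps)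
    ultimately show ?thesis using s k by (simp add: s_def[symmetric] pos_divide_le_eq)
  qed
  have "admissible_stepsize L p q \<gamma>' \<longleftrightarrow> 0 < \<gamma>' \<and> \<gamma>' \<le> \<gamma>" for \<gamma>'
    by (simp add: admissible_stepsize_def admissible_bound del: times_divide_eq_right times_divide_eq_left)
  then show ?thesis
    using q_bounds p_pos p_le \<gamma>_pos complexity closed_form bound expectation_local_gradients
    by simp
qed

end
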